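(* Let $\Gamma$ be a connected finite simplicial graph. If $\Gamma$ admits a tree $2$-spanner, then the flag complex $\Delta_\Gamma$ is contractible.
   Context: A tree $2$-spanner of a connected graph $\Gamma$ is a spanning tree $T$ of $\Gamma$ such that $d_T(x,y)\le 2\,d_\Gamma(x,y)$ for all $x,y\in V(\Gamma)$, where $d_T$ and $d_\Gamma$ are the graph metrics. The flag complex $\Delta_\Gamma$ is the simplicial complex whose simplices are the nonempty sets of pairwise adjacent vertices of $\Gamma$. *)

theory Defs
  imports
    "HOL-Analysis.Analysis"
    "Graph_Theory.Digraph_Component"
    "Graph_Theory.Pair_Digraph"
    "Graph_Theory.Shortest_Path"
begin

text \<open>
  Finite simplicial graphs are rendered by the locale \<open>pair_graph\<close>: finite loopless
  symmetric digraphs whose arcs are pairs of vertices, so that an undirected edge is a pair of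
  opposite arcs. The name \<open>connected\<close> is qualified below because it also denotes
  topological connectedness; graph connectedness includes having at least one vertex.
\<close>

definition graph_dist :: "'a pair_pre_digraph \<Rightarrow> 'a \<Rightarrow> 'a \<Rightarrow> ereal" where
  "graph_dist G = wf_digraph.\<mu> (with_proj G) (\<lambda>_. 1)"

text \<open>
  The library predicates \<open>forest\<close> and \<open>tree\<close> are about directed cycles, so on a symmetric
  digraph they already exclude the closed walk \<open>u, v, u\<close> along a single edge. The cycles of
  the undirected graph are the directed cycles of length at least 3.
\<close>

definition undirected_tree :: "'a pair_pre_digraph \<Rightarrow> bool" where
  "undirected_tree T \<longleftrightarrow>
     pair_graph T \<and> Digraph_Component.connected (with_proj T) \<and>
     \<not> (\<exists>p. pre_digraph.cycle (with_proj T) p \<and> 3 \<le> length p)"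

definition tree_2_spanner :: "'a pair_pre_digraph \<Rightarrow> 'a pair_pre_digraph \<Rightarrow> bool" where
  "tree_2_spanner T G \<longleftrightarrow>
     undirected_tree T \<and> spanning (with_proj T) (with_proj G) \<and>
     (\<forall>x\<in>pverts G. \<forall>y\<in>pverts G. graph_dist T x y \<le> 2 * graph_dist G x y)"

definition flag_complex :: "'a pair_pre_digraph \<Rightarrow> 'a set set" where
  "flag_complex G =
     {s. s \<noteq> {} \<and> finite s \<and> s \<subseteq> pverts G \<and> (\<forall>u\<in>s. \<forall>v\<in>s. u \<noteq> v \<longrightarrow> (u, v) \<in> parcs G)}"

text \<open>
  Points of the realization of an abstract simplicial complex (given as its set of nonempty
  finite simplices) are barycentric coordinate functions. The topology is that of a subspace of
  the product of copies of the real line, which for a finite complex is the usual one (it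
  agrees with the weak topology); it is not meant for infinite complexes.
\<close>

definition geometric_realization :: "'a set set \<Rightarrow> ('a \<Rightarrow> real) topology" where
  "geometric_realization K =
     subtopology (powertop_real UNIV)
       {f. (\<forall>v. 0 \<le> f v) \<and> {v. f v \<noteq> 0} \<in> K \<and> (\<Sum>v\<in>{v. f v \<noteq> 0}. f v) = 1}"

end

theory Submission
  imports Defs
begin

text \<open>
  Let \<open>v\<close> be a leaf of the 2-spanner \<open>T\<close>, with tree neighbour \<open>w\<close>. A graph neighbour of \<open>v\<close> is at
  tree distance at most 2 from \<open>v\<close>, hence equals \<open>w\<close> or is a tree neighbour of \<open>w\<close>. So \<open>w\<close>
  dominates \<open>v\<close>, and sliding the barycentric weight of \<open>v\<close> to \<open>w\<close> deforms the flag complex onto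
  that of the graph without \<open>v\<close>. Removing leaves of \<open>T\<close> one by one ends in a single point.
\<close>

section \<open>Deformations of the geometric realization\<close>

lemma topspace_geometric_realization:
  "topspace (geometric_realization K) =
     {f. (\<forall>v. 0 \<le> f v) \<and> {v. f v \<noteq> 0} \<in> K \<and> (\<Sum>v\<in>{v. f v \<noteq> 0}. f v) = 1}"
  by (simp add: geometric_realization_def)

lemma continuous_map_geometric_realization_coord:
  "continuous_map (geometric_realization K) euclideanreal (\<lambda>f. f x)"
  unfolding geometric_realization_def
  by (intro continuous_map_from_subtopology continuous_map_product_projection) simp

lemma continuous_map_into_geometric_realization:
  assumes "\<And>x. continuous_map X euclideanreal (\<lambda>y. g y x)"
    and "\<And>y. y \<in> topspace X \<Longrightarrow> g y \<in> topspace (geometric_realization K)"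
  shows "continuous_map X (geometric_realization K) g"
  using assms unfolding topspace_geometric_realization unfolding geometric_realization_def
  by (auto simp: continuous_map_in_subtopology continuous_map_componentwise_UNIV)

text \<open>Here \<open>t\<close> is the time of a homotopy that never moves a point with
  \<open>f v = 0\<close>, so that it can give a strong deformation retraction.\<close>

definition slide :: "'a \<Rightarrow> 'a \<Rightarrow> real \<Rightarrow> ('a \<Rightarrow> real) \<Rightarrow> 'a \<Rightarrow> real" where
  "slide v w t f = f(v := (1 - t) * f v, w := f w + t * f v)"

text \<open>Weight only moves from \<open>v\<close> to \<open>w\<close>, so the sum stays 1. If
  \<open>f v\<close> is nonzero, the new support lies in the old one with \<open>w\<close> added,
  which is a simplex by the third assumption on \<open>K\<close>: domination of \<open>v\<close> by
  \<open>w\<close>.\<close>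

lemma slide_in_geometric_realization:
  assumes K: "\<And>s. s \<in> K \<Longrightarrow> finite s"
      "\<And>s t. s \<in> K \<Longrightarrow> t \<subseteq> s \<Longrightarrow> t \<noteq> {} \<Longrightarrow> t \<in> K"
      "\<And>s. s \<in> K \<Longrightarrow> v \<in> s \<Longrightarrow> insert w s \<in> K"
    and "v \<noteq> w" and t: "0 \<le> t" "t \<le> 1"
    and f: "f \<in> topspace (geometric_realization K)"
  shows "slide v w t f \<in> topspace (geometric_realization K)"
proof (cases "f v = 0")
  \<comment> \<open>Domination says nothing about supports that omit \<open>v\<close>, but such
    points do not move.\<close>
  case True
  then have "slide v w t f = f"
    by (auto simp: slide_def)
  with f show ?thesis by simp
next
  case False
  let ?s = "{x. f x \<noteq> 0}" and ?g = "slide v w t f"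
  have f': "\<And>x. 0 \<le> f x" "?s \<in> K" "sum f ?s = 1"
    using f by (auto simp: topspace_geometric_realization)
  let ?u = "insert w ?s"
  have fin: "finite ?u" and u: "?u \<in> K"
    using K(1,3)[OF f'(2)] False by auto
  have nonneg: "\<forall>x. 0 \<le> ?g x"
    using f'(1) t by (auto simp: slide_def)
  have supp: "{x. ?g x \<noteq> 0} \<subseteq> ?u"
    using False by (auto simp: slide_def split: if_splits)
  \<comment> \<open>An arbitrary \<open>h\<close> lets this serve both \<open>?g\<close> and
    \<open>f\<close>, which agree away from \<open>v\<close> and \<open>w\<close>.\<close>
  have split: "sum h ?u = h v + h w + sum h (?u - {v, w})" for h :: "'a \<Rightarrow> real"
  proof -
    have "sum h ?u = sum h {v, w} + sum h (?u - {v, w})"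
      using fin False sum.subset_diff[of "{v, w}" ?u h] by (simp add: add.commute)
    then show ?thesis using \<open>v \<noteq> w\<close> by simp
  qed
  have "sum ?g {x. ?g x \<noteq> 0} = sum ?g ?u"
    using fin supp by (intro sum.mono_neutral_left) auto
  also have "\<dots> = sum f ?u"
  proof -
    have "sum ?g (?u - {v, w}) = sum f (?u - {v, w})"
      by (intro sum.cong) (auto simp: slide_def)
    then show ?thesis
      unfolding split using \<open>v \<noteq> w\<close> by (simp add: slide_def algebra_simps)
  qed
  also have "\<dots> = sum f ?s"
    using fin by (intro sum.mono_neutral_right) auto
  finally have sum1: "sum ?g {x. ?g x \<noteq> 0} = 1" using f'(3) by simp
  then have "{x. ?g x \<noteq> 0} \<noteq> {}" by force
  then have "{x. ?g x \<noteq> 0} \<in> K" using K(2)[OF u supp] by simp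
  with nonneg sum1 show ?thesis
    by (simp add: topspace_geometric_realization)
qed

text \<open>The map \<open>slide v w 1\<close> is a strong deformation retraction onto the
  subcomplex that avoids \<open>v\<close>; its homotopy inverse is the inclusion.\<close>

lemma delete_dominated_vertex_homotopy_equivalent:
  assumes K: "\<And>s. s \<in> K \<Longrightarrow> finite s"
      "\<And>s t. s \<in> K \<Longrightarrow> t \<subseteq> s \<Longrightarrow> t \<noteq> {} \<Longrightarrow> t \<in> K"
      "\<And>s. s \<in> K \<Longrightarrow> v \<in> s \<Longrightarrow> insert w s \<in> K"
    and "v \<noteq> w"
  shows "geometric_realization K homotopy_equivalent_space
           geometric_realization {s \<in> K. v \<notin> s}"
proof -
  let ?X = "geometric_realization K" and ?Y = "geometric_realization {s \<in> K. v \<notin> s}"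
  \<comment> \<open>The smaller realization is the locus \<open>f v = 0\<close> in the larger one,
    so \<open>id\<close> serves as the inclusion.\<close>
  have Y: "topspace ?Y = {f \<in> topspace ?X. f v = 0}"
    by (auto simp: topspace_geometric_realization)
  note slide_X = slide_in_geometric_realization[OF K \<open>v \<noteq> w\<close>]
  have slide_v: "slide v w 1 f v = 0" for f
    using \<open>v \<noteq> w\<close> by (simp add: slide_def)
  have slide_id: "slide v w t f = f" if "f v = 0" for t f
    using that by (auto simp: slide_def)
  have r: "continuous_map ?X ?Y (slide v w 1)"
  proof (rule continuous_map_into_geometric_realization)
    show "continuous_map ?X euclideanreal (\<lambda>f. slide v w 1 f x)" for x
      by (cases "x = v"; cases "x = w")
        (auto simp: slide_def
          intro!: continuous_intros continuous_map_geometric_realization_coord)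
  qed (auto simp: Y slide_v slide_X)
  have i: "continuous_map ?Y ?X id"
    by (rule continuous_map_into_geometric_realization)
      (auto simp: Y continuous_map_geometric_realization_coord)
  have "homotopic_with (\<lambda>_. True) ?X ?X id (slide v w 1)"
  proof -
    let ?P = "prod_topology (top_of_set {0..1::real}) ?X"
    have "continuous_map ?P ?X (\<lambda>(t, f). slide v w t f)"
    proof (rule continuous_map_into_geometric_realization)
      have coord: "continuous_map ?P euclideanreal (\<lambda>p. snd p x)" for x
        using continuous_map_compose[OF continuous_map_snd
            continuous_map_geometric_realization_coord]
        by (simp add: o_def)
      have time: "continuous_map ?P euclideanreal fst"
        using continuous_map_fst continuous_map_into_fulltopology by blast
      show "continuous_map ?P euclideanreal (\<lambda>p. (case p of (t, f) \<Rightarrow> slide v w t f) x)" for x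
        by (cases "x = v"; cases "x = w")
          (auto simp: slide_def case_prod_unfold intro!: continuous_intros coord time)
    qed (auto simp: slide_X)
    then show ?thesis
      unfolding homotopic_with_def
      by (intro exI[of _ "\<lambda>(t, f). slide v w t f"]) (auto simp: slide_def)
  qed
  moreover have "homotopic_with (\<lambda>_. True) ?Y ?Y (slide v w 1 \<circ> id) id"
    using continuous_map_compose[OF i r] by (intro homotopic_with_equal) (auto simp: Y slide_id)
  ultimately show ?thesis
    unfolding homotopy_equivalent_space_def using r i
    by (intro exI[of _ "slide v w 1"] exI[of _ id]) (auto simp: homotopic_with_sym)
qed

lemma contractible_geometric_realization_point:
  "contractible_space (geometric_realization {{r}})"
proof (rule contractible_space_subset_singleton)
  show "topspace (geometric_realization {{r}}) \<subseteq> {\<lambda>x. if x = r then 1 else 0}"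
  proof
    fix f :: "'a \<Rightarrow> real"
    assume "f \<in> topspace (geometric_realization {{r}})"
    then have s: "{x. f x \<noteq> 0} = {r}" and "sum f {x. f x \<noteq> 0} = 1"
      by (auto simp: topspace_geometric_realization)
    then have "f r = 1" by simp
    moreover have "f x = 0" if "x \<noteq> r" for x using s that by blast
    ultimately show "f \<in> {\<lambda>x. if x = r then 1 else 0}" by auto
  qed
qed

section \<open>Leaves of acyclic relations and the induction on the vertex set\<close>

text \<open>The first vertex of a longest path is a leaf.\<close>

lemma acyclic_obtains_leaf:
  fixes R :: "'a rel"
  assumes W: "finite W" and R: "sym R" "irrefl R"
    and acyc: "\<forall>xs. distinct xs \<and> successively (\<lambda>x y. (x, y) \<in> R) xs \<and> 3 \<le> length xs
                 \<longrightarrow> (last xs, hd xs) \<notin> R"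
    and ab: "(a, b) \<in> R" "a \<in> W" "b \<in> W"
  obtains v w where "v \<in> W" "w \<in> W" "(v, w) \<in> R" "\<And>u. u \<in> W \<Longrightarrow> (v, u) \<in> R \<Longrightarrow> u = w"
proof -
  \<comment> \<open>Paths stay in \<open>W\<close>, so the leaf is one relative to \<open>W\<close>;
    \<open>acyc\<close> is about all lists and so survives the deletion of vertices.\<close>
  define path where
    "path xs \<longleftrightarrow> distinct xs \<and> set xs \<subseteq> W \<and> successively (\<lambda>x y. (x, y) \<in> R) xs" for xs
  have "path [a, b]"
    using ab R by (auto simp: path_def irrefl_def)
  have "length xs \<le> card W" if "path xs" for xs
    using W that card_mono[of W "set xs"] by (simp add: path_def distinct_card)
  then have "\<forall>xs. path xs \<longrightarrow> length xs < Suc (card W)"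
    by (simp add: less_Suc_eq_le)
  from ex_has_greatest_nat[OF \<open>path [a, b]\<close> this]
  obtain xs where xs: "path xs" and max: "\<And>ys. path ys \<Longrightarrow> length ys \<le> length xs"
    by metis
  \<comment> \<open>Length at least 2 provides the second vertex \<open>w\<close>, which will be the
    only neighbour of \<open>v\<close>.\<close>
  from max[OF \<open>path [a, b]\<close>] have "2 \<le> length xs" by simp
  then obtain v w ys where eq: "xs = v # w # ys"
    by (cases xs rule: remdups_adj.cases) auto
  have "u = w" if u: "u \<in> W" "(v, u) \<in> R" for u
  proof (rule ccontr)
    assume "u \<noteq> w"
    have uv: "(u, v) \<in> R" using u R by (auto dest: symD)
    \<comment> \<open>A neighbour of \<open>v\<close> in \<open>W\<close> outside the path would
      prolong it at the front.\<close>
    have "\<not> path (u # xs)" using max[of "u # xs"] by auto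
    then have "u \<in> set xs" using xs u uv by (auto simp: path_def eq)
    then have "u \<in> set ys" using u \<open>u \<noteq> w\<close> R by (auto simp: eq irrefl_def)
    then obtain as bs where ys: "ys = as @ u # bs" by (auto simp: in_set_conv_decomp)
    \<comment> \<open>The initial segment up to \<open>u\<close> is closed to a cycle by the edge
      from \<open>u\<close> to \<open>v\<close>. It has at least three vertices because
      \<open>u\<close> comes after \<open>w\<close>.\<close>
    let ?zs = "v # w # as @ [u]"
    have "path (?zs @ bs)" using xs by (simp add: eq ys)
    then have "distinct ?zs" "successively (\<lambda>x y. (x, y) \<in> R) ?zs"
      unfolding path_def distinct_append successively_append_iff by blast+
    then show False using acyc[rule_format, of ?zs] uv by simp
  qed
  moreover have "v \<in> W" "w \<in> W" "(v, w) \<in> R" using xs by (auto simp: path_def eq)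
  ultimately show ?thesis using that by blast
qed

text \<open>
  In the induction \<open>R\<close> and \<open>E\<close> are kept fixed and only the vertex set shrinks. The assumption
  \<open>near\<close> is the 2-spanner property of \<open>W\<close>, and \<open>cut\<close> its connectedness in \<open>R\<close>.
\<close>

lemma contractible_flag_complex_tree_neighbours:
  fixes R E :: "'a rel"
  assumes W: "finite W" "W \<noteq> {}" and R: "sym R" "irrefl R" and E: "sym E" "R \<subseteq> E"
    and acyc: "\<forall>xs. distinct xs \<and> successively (\<lambda>x y. (x, y) \<in> R) xs \<and> 3 \<le> length xs
                 \<longrightarrow> (last xs, hd xs) \<notin> R"
    and near: "\<And>u v. u \<in> W \<Longrightarrow> v \<in> W \<Longrightarrow> u \<noteq> v \<Longrightarrow> (u, v) \<in> E
                 \<Longrightarrow> (u, v) \<in> R \<or> (\<exists>w\<in>W. (u, w) \<in> R \<and> (w, v) \<in> R)"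
    and cut: "\<And>A. A \<subset> W \<Longrightarrow> A \<noteq> {} \<Longrightarrow> \<exists>x\<in>A. \<exists>y\<in>W - A. (x, y) \<in> R"
  shows "contractible_space (geometric_realization (flag_complex \<lparr>pverts = W, parcs = E\<rparr>))"
  using W near cut
proof (induction "card W" arbitrary: W rule: less_induct)
  case less
  note near = less.prems(3) and cut = less.prems(4)
  obtain r where "r \<in> W" using less.prems by auto
  show ?case
  proof (cases "W = {r}")
    case True
    then have "flag_complex \<lparr>pverts = W, parcs = E\<rparr> = {{r}}"
      by (auto simp: flag_complex_def)
    then show ?thesis by (simp add: contractible_geometric_realization_point)
  next
    case False
    then have "{r} \<subset> W" using \<open>r \<in> W\<close> by auto
    \<comment> \<open>The cut around \<open>r\<close> supplies the edge from which the search for a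
      leaf starts.\<close>
    then obtain b where "(r, b) \<in> R" "b \<in> W" using cut[of "{r}"] by auto
    then obtain v w where vw: "v \<in> W" "w \<in> W" "(v, w) \<in> R"
      and leaf: "\<And>u. u \<in> W \<Longrightarrow> (v, u) \<in> R \<Longrightarrow> u = w"
      using acyclic_obtains_leaf[OF \<open>finite W\<close> R acyc _ \<open>r \<in> W\<close>] by blast
    have "v \<noteq> w" using vw R by (auto simp: irrefl_def)
    have leaf': "u = w" if "u \<in> W" "(u, v) \<in> R" for u
      using leaf that R by (auto dest: symD)
    let ?K = "flag_complex \<lparr>pverts = W, parcs = E\<rparr>"
    let ?W' = "W - {v}"
    have "contractible_space (geometric_realization (flag_complex \<lparr>pverts = ?W', parcs = E\<rparr>))"
    proof (rule less.hyps)
      show "card ?W' < card W" using vw \<open>finite W\<close> by (intro card_Diff1_less)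
      show "finite ?W'" using \<open>finite W\<close> by simp
      show "?W' \<noteq> {}" using vw \<open>v \<noteq> w\<close> by auto
      \<comment> \<open>The middle vertex cannot be \<open>v\<close>, since both ends would then
        equal \<open>w\<close>.\<close>
      show "(x, y) \<in> R \<or> (\<exists>z\<in>?W'. (x, z) \<in> R \<and> (z, y) \<in> R)"
        if "x \<in> ?W'" "y \<in> ?W'" "x \<noteq> y" "(x, y) \<in> E" for x y
        using near[of x y] that leaf leaf' by blast
      \<comment> \<open>Put \<open>v\<close> on the same side as \<open>w\<close>. An edge crossing
        this cut of \<open>W\<close> cannot involve \<open>v\<close>, whose only neighbour in
        \<open>W\<close> is \<open>w\<close>.\<close>
      show "\<exists>x\<in>A. \<exists>y\<in>?W' - A. (x, y) \<in> R" if A: "A \<subset> ?W'" "A \<noteq> {}" for A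
      proof (cases "w \<in> A")
        case True
        have "insert v A \<subset> W" using A vw by auto
        then obtain x y where "x \<in> insert v A" "y \<in> W - insert v A" "(x, y) \<in> R"
          using cut[of "insert v A"] by blast
        then show ?thesis using leaf True by blast
      next
        case False
        have "A \<subset> W" using A by auto
        then obtain x y where "x \<in> A" "y \<in> W - A" "(x, y) \<in> R"
          using cut[of A] A by blast
        then show ?thesis using leaf'[of x] False A by blast
      qed
    qed
    moreover have "flag_complex \<lparr>pverts = ?W', parcs = E\<rparr> = {s \<in> ?K. v \<notin> s}"
      by (auto simp: flag_complex_def)
    moreover have "geometric_realization ?K homotopy_equivalent_space
        geometric_realization {s \<in> ?K. v \<notin> s}"
    proof (rule delete_dominated_vertex_homotopy_equivalent)
      \<comment> \<open>A common tree neighbour of \<open>u\<close> and \<open>v\<close> in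
        \<open>W\<close> can only be \<open>w\<close>; this turns \<open>near\<close> into
        domination.\<close>
      have dom: "(u, w) \<in> E \<and> (w, u) \<in> E" if "u \<in> W" "u \<noteq> w" "u = v \<or> (u, v) \<in> E" for u
      proof -
        have "(u, w) \<in> R"
          using near[of u v] that vw leaf' by blast
        then show ?thesis using E by (auto dest: symD)
      qed
      show "insert w s \<in> ?K" if "s \<in> ?K" "v \<in> s" for s
        using that dom vw by (auto simp: flag_complex_def subset_iff)
    qed (use \<open>v \<noteq> w\<close> in \<open>auto simp: flag_complex_def intro: finite_subset\<close>)
    ultimately show ?thesis
      using homotopy_equivalent_space_contractibility by metis
  qed
qed

section \<open>Translation between library walks and distances and vertex lists and
  relations\<close>

lemma (in pair_wf_digraph) successively_imp_awalk:
  assumes "successively (\<lambda>x y. (x, y) \<in> parcs G) xs" "xs \<noteq> []" "hd xs \<in> pverts G"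
  shows "awalk (hd xs) (zip xs (tl xs)) (last xs)"
    and "pawalk_verts (hd xs) (zip xs (tl xs)) = xs"
proof -
  have "set (zip xs (tl xs)) \<subseteq> parcs G \<and> pcas (hd xs) (zip xs (tl xs)) (last xs)
      \<and> pawalk_verts (hd xs) (zip xs (tl xs)) = xs"
    using assms(1,2)
  proof (induction xs)
    case (Cons x xs)
    then show ?case by (cases xs) auto
  qed simp
  \<comment> \<open>A one-element list gives the walk without arcs, so that \<open>hd xs\<close> is
    a vertex must come from the assumption.\<close>
  then show "awalk (hd xs) (zip xs (tl xs)) (last xs)"
    and "pawalk_verts (hd xs) (zip xs (tl xs)) = xs"
    using assms(3) by (auto simp: awalk_def)
qed

lemma (in pair_wf_digraph) successively_imp_cycle:
  assumes "distinct xs" "successively (\<lambda>x y. (x, y) \<in> parcs G) xs" "xs \<noteq> []"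
    and last: "(last xs, hd xs) \<in> parcs G"
  shows "\<exists>p. cycle p \<and> length p = length xs"
proof -
  \<comment> \<open>Repeating the first vertex adds the closing arc, so there is one arc per entry
    of \<open>xs\<close>; the tail of \<open>?ys\<close> is a rotation of \<open>xs\<close>, hence
    distinct.\<close>
  let ?ys = "xs @ [hd xs]"
  let ?p = "zip ?ys (tl ?ys)"
  have "successively (\<lambda>x y. (x, y) \<in> parcs G) ?ys" "hd ?ys = hd xs" "hd ?ys \<in> pverts G"
    using assms last by (auto simp: successively_append_iff dest: in_arcsD2)
  then have "awalk (hd xs) ?p (hd xs)" "pawalk_verts (hd xs) ?p = ?ys"
    using successively_imp_awalk[of ?ys] by auto
  moreover have "distinct (tl ?ys)" "length ?p = length xs"
    using assms(1,3) by (cases xs; simp)+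
  ultimately show ?thesis
    using \<open>xs \<noteq> []\<close> unfolding cycle_def by (intro exI[of _ ?p]) auto
qed

lemma (in pair_wf_digraph) graph_dist_le_1:
  assumes "(u, v) \<in> parcs G"
  shows "graph_dist G u v \<le> 1"
proof -
  have "awalk u [(u, v)] v"
    using assms by (auto simp: awalk_def dest: in_arcsD1)
  from min_cost_le_walk_cost[OF this, of "\<lambda>_. 1"] show ?thesis
    by (simp add: graph_dist_def awalk_cost_def one_ereal_def)
qed

lemma (in pair_wf_digraph) graph_dist_le_2_cases:
  assumes "graph_dist G u v \<le> 2"
  shows "u = v \<or> (u, v) \<in> parcs G \<or> (\<exists>w. (u, w) \<in> parcs G \<and> (w, v) \<in> parcs G)"
proof -
  \<comment> \<open>Since \<open>\<mu>\<close> is an infimum, a strict bound is what produces an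
    actual walk. Its cost is its length, an integer below 3.\<close>
  have "\<mu> (\<lambda>_. 1) u v < ereal 3"
  proof (rule le_less_trans)
    show "\<mu> (\<lambda>_. 1) u v \<le> 2" using assms by (simp add: graph_dist_def)
  qed simp
  then obtain p where p: "awalk u p v" "awalk_cost (\<lambda>_. 1) p < 3"
    by (auto simp: \<mu>_def INF_less_iff)
  have "awalk_cost (\<lambda>_. 1) q = real (length q)" for q :: "('a \<times> 'a) list"
    by (simp add: awalk_cost_def sum_list_triv)
  with p(2) have "length p < 3" by simp
  then consider "p = []" | e where "p = [e]" | e f where "p = [e, f]"
    by (cases p rule: remdups_adj.cases) auto
  then show ?thesis
  proof cases
    case (2 e)
    with p(1) show ?thesis by (cases e) (simp add: awalk_def)
  next
    case (3 e f)
    with p(1) show ?thesis by (cases e; cases f) (auto simp: awalk_def)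
  qed (use p(1) in \<open>simp add: awalk_def\<close>)
qed

text \<open>If no arc left \<open>A\<close>, everything reachable from a vertex of \<open>A\<close>
  would lie in \<open>A\<close>.\<close>

lemma (in pair_pseudo_graph) connected_cut:
  assumes "Digraph_Component.connected (with_proj G)" and A: "A \<subset> pverts G" "A \<noteq> {}"
  shows "\<exists>x\<in>A. \<exists>y\<in>pverts G - A. (x, y) \<in> parcs G"
proof (rule ccontr)
  assume *: "\<not> ?thesis"
  obtain a b where ab: "a \<in> A" "b \<in> pverts G" "b \<notin> A" using A by auto
  then have "a \<rightarrow>\<^sup>*\<^bsub>mk_symmetric (with_proj G)\<^esub> b"
    using assms A by (auto simp: connected_def strongly_connected_def)
  \<comment> \<open>Connectedness is defined through the symmetric closure, which adds no
    reachability in a symmetric digraph.\<close>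
  then have "a \<rightarrow>\<^sup>*\<^bsub>with_proj G\<^esub> b"
    using reachable_mk_symmetric_eq[OF pair_sym_arcs] by simp
  then have "b \<in> A"
  proof (induction rule: reachable_induct)
    case (step x y)
    then show ?case using * in_arcsD2 by auto
  qed (rule \<open>a \<in> A\<close>)
  with ab show False by simp
qed

theorem corollary3p9:
  fixes \<Gamma> :: "'a pair_pre_digraph"
  assumes "pair_graph \<Gamma>"
    and "Digraph_Component.connected (with_proj \<Gamma>)"
    and "\<exists>T. tree_2_spanner T \<Gamma>"
  shows "contractible_space (geometric_realization (flag_complex \<Gamma>))"
proof -
  obtain T where T: "pair_graph T" "Digraph_Component.connected (with_proj T)"
      "\<And>p. pre_digraph.cycle (with_proj T) p \<Longrightarrow> \<not> 3 \<le> length p"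
    and span: "spanning (with_proj T) (with_proj \<Gamma>)"
    and dist: "\<And>x y. x \<in> pverts \<Gamma> \<Longrightarrow> y \<in> pverts \<Gamma> \<Longrightarrow> graph_dist T x y \<le> 2 * graph_dist \<Gamma> x y"
    using assms(3) by (auto simp: tree_2_spanner_def undirected_tree_def)
  interpret G: pair_graph \<Gamma> by fact
  interpret T: pair_graph T by fact
  have V: "pverts T = pverts \<Gamma>" and sub: "parcs T \<subseteq> parcs \<Gamma>"
    using span by (auto simp: spanning_def subgraph_def)
  \<comment> \<open>The graph is spelled out as a record to match the form used in the
    induction.\<close>
  have "contractible_space
      (geometric_realization (flag_complex \<lparr>pverts = pverts \<Gamma>, parcs = parcs \<Gamma>\<rparr>))"
  proof (rule contractible_flag_complex_tree_neighbours[where R = "parcs T"])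
    show "finite (pverts \<Gamma>)" by (rule G.pair_finite_verts)
    show "pverts \<Gamma> \<noteq> {}"
      using assms(2) by (auto simp: connected_def strongly_connected_def)
    show "sym (parcs T)" "sym (parcs \<Gamma>)"
      using T.pair_sym_arcs G.pair_sym_arcs by (auto simp: symmetric_def)
    show "irrefl (parcs T)"
      using T.pair_no_loops by (force simp: irrefl_def)
    show "\<forall>xs. distinct xs \<and> successively (\<lambda>x y. (x, y) \<in> parcs T) xs \<and> 3 \<le> length xs
        \<longrightarrow> (last xs, hd xs) \<notin> parcs T"
      using T.successively_imp_cycle T(3) by fastforce
    show "(u, v) \<in> parcs T \<or> (\<exists>w\<in>pverts \<Gamma>. (u, w) \<in> parcs T \<and> (w, v) \<in> parcs T)"
      if "u \<in> pverts \<Gamma>" "v \<in> pverts \<Gamma>" "u \<noteq> v" "(u, v) \<in> parcs \<Gamma>" for u v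
    proof -
      \<comment> \<open>The ends of an edge are at distance at most 1 in the graph, hence at most 2
        in the tree.\<close>
      have "graph_dist T u v \<le> 2 * graph_dist \<Gamma> u v" using dist that by simp
      also have "\<dots> \<le> 2 * 1"
        using G.graph_dist_le_1[OF that(4)] by (intro ereal_mult_left_mono) auto
      finally show ?thesis
        using T.graph_dist_le_2_cases[of u v] \<open>u \<noteq> v\<close> V T.in_arcsD2 by auto
    qed
    show "\<exists>x\<in>A. \<exists>y\<in>pverts \<Gamma> - A. (x, y) \<in> parcs T" if "A \<subset> pverts \<Gamma>" "A \<noteq> {}" for A
      using T.connected_cut[OF T(2)] that V by simp
  qed (rule sub)
  then show ?thesis by (cases \<Gamma>) simp
qed

end
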